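(* There does not exist a total $k$-uniform graph when $k$ is an odd positive integer.
   Context: All graphs are finite and simple. For a vertex $v$ of a graph $G$, $N(v)$ is the set of neighbors of $v$. For a graph $G$ with no isolated vertices, a set $A\subseteq V(G)$ is a total dominating set if every vertex of $G$ has a neighbor in $A$; the total domination number $\gamma_t(G)$ is the minimum size of a total dominating set. A sequence $(v_1,\dots,v_m)$ of distinct vertices is legal if $N(v_i)\setminus\bigcup_{j=1}^{i-1}N(v_j)\neq\emptyset$ for every $i\in\{2,\dots,m\}$; it is a total dominating sequence if moreover $\{v_1,\dots,v_m\}$ is a total dominating set. The Grundy total domination number $\gamma_{gr}^t(G)$ is the maximum length of a total dominating sequence. A graph $G$ (with no isolated vertices) is total $k$-uniform if $\gamma_t(G)=\gamma_{gr}^t(G)=k$, i.e. every total dominating sequence of $G$ has length $k$. *)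

theory Defs
  imports "Graph_Theory.Pair_Digraph"
begin

text \<open>
  Finite simple graphs are the instances of the locale \<open>pair_graph\<close>: a finite vertex set
  \<open>pverts G\<close> and a symmetric irreflexive relation \<open>parcs G\<close> on it, each edge \<open>uv\<close> being
  represented by the two arcs \<open>(u, v)\<close> and \<open>(v, u)\<close>.
\<close>

definition nbhd :: "'a pair_pre_digraph \<Rightarrow> 'a \<Rightarrow> 'a set" where
  "nbhd G v = {u. (v, u) \<in> parcs G}"

definition no_isolated_verts :: "'a pair_pre_digraph \<Rightarrow> bool" where
  "no_isolated_verts G \<longleftrightarrow> (\<forall>v\<in>pverts G. nbhd G v \<noteq> {})"

definition total_dominating_set :: "'a pair_pre_digraph \<Rightarrow> 'a set \<Rightarrow> bool" where
  "total_dominating_set G A \<longleftrightarrow>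
     A \<subseteq> pverts G \<and> (\<forall>v\<in>pverts G. nbhd G v \<inter> A \<noteq> {})"

definition total_domination_number :: "'a pair_pre_digraph \<Rightarrow> nat" where
  "total_domination_number G = Min {card A | A. total_dominating_set G A}"

text \<open>
  Lists are indexed from \<open>0\<close>, so \<open>vs ! i\<close> is the vertex written $v_{i+1}$; as usual, the first
  vertex of a legal sequence is not subject to the neighbourhood condition.
\<close>

definition legal_sequence :: "'a pair_pre_digraph \<Rightarrow> 'a list \<Rightarrow> bool" where
  "legal_sequence G vs \<longleftrightarrow>
     distinct vs \<and> set vs \<subseteq> pverts G \<and>
     (\<forall>i\<in>{1..<length vs}. nbhd G (vs ! i) - (\<Union>j<i. nbhd G (vs ! j)) \<noteq> {})"

definition total_dominating_sequence :: "'a pair_pre_digraph \<Rightarrow> 'a list \<Rightarrow> bool" where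
  "total_dominating_sequence G vs \<longleftrightarrow>
     legal_sequence G vs \<and> total_dominating_set G (set vs)"

definition grundy_total_domination_number :: "'a pair_pre_digraph \<Rightarrow> nat" where
  "grundy_total_domination_number G = Max {length vs | vs. total_dominating_sequence G vs}"

definition total_uniform :: "nat \<Rightarrow> 'a pair_pre_digraph \<Rightarrow> bool" where
  "total_uniform k G \<longleftrightarrow>
     no_isolated_verts G \<and>
     total_domination_number G = k \<and> grundy_total_domination_number G = k"

text \<open>
  On a finite simple graph without isolated vertices the minimum and the maximum above are taken
  over nonempty finite sets, and total \<open>k\<close>-uniformity says that all total dominating
  sequences have length \<open>k\<close>.
\<close>

lemma finite_total_dominating_cards:
  assumes "pair_graph G"
  shows "finite {card A | A. total_dominating_set G A}"
proof -
  interpret pair_graph G by fact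
  have "{card A | A. total_dominating_set G A} \<subseteq> card ` Pow (pverts G)"
    by (auto simp: total_dominating_set_def)
  then show ?thesis
    using pair_finite_verts by (meson finite_Pow_iff finite_imageI finite_subset)
qed

lemma total_dominating_set_pverts:
  assumes "pair_graph G" "no_isolated_verts G"
  shows "total_dominating_set G (pverts G)"
proof -
  interpret pair_graph G by fact
  show ?thesis
    using assms(2) in_arcsD2
    by (fastforce simp: total_dominating_set_def no_isolated_verts_def nbhd_def)
qed

lemma finite_total_dominating_lengths:
  assumes "pair_graph G"
  shows "finite {length vs | vs. total_dominating_sequence G vs}"
proof -
  interpret pair_graph G by fact
  have "length vs \<le> card (pverts G)" if "total_dominating_sequence G vs" for vs
    using that pair_finite_verts
    by (metis card_mono distinct_card legal_sequence_def total_dominating_sequence_def)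
  then have "{length vs | vs. total_dominating_sequence G vs} \<subseteq> {..card (pverts G)}"
    by auto
  then show ?thesis
    by (rule finite_subset) simp
qed

lemma total_dominating_sequence_minimum:
  assumes "pair_graph G" "no_isolated_verts G"
  obtains vs where "total_dominating_sequence G vs" "length vs = total_domination_number G"
proof -
  interpret pair_graph G by fact
  let ?C = "{card A | A. total_dominating_set G A}"
  have "Min ?C \<in> ?C"
    using finite_total_dominating_cards[OF assms(1)] total_dominating_set_pverts[OF assms]
    by (intro Min_in) auto
  then obtain A where A: "total_dominating_set G A" "card A = Min ?C"
    by auto
  have fin: "finite A"
    using A(1) pair_finite_verts by (auto simp: total_dominating_set_def intro: finite_subset)
  then obtain vs where vs: "set vs = A" "distinct vs"
    using finite_distinct_list by auto
  have priv: "\<exists>u\<in>pverts G. nbhd G u \<inter> (A - {a}) = {}" if "a \<in> A" for a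
  proof (rule ccontr)
    assume "\<not> ?thesis"
    then have "total_dominating_set G (A - {a})"
      using A(1) by (auto simp: total_dominating_set_def)
    then have "Min ?C \<le> card (A - {a})"
      using finite_total_dominating_cards[OF assms(1)] by (intro Min_le) auto
    moreover have "card (A - {a}) < card A"
      using that fin by (intro card_Diff1_less)
    ultimately show False using A(2) by simp
  qed
  have sym: "u \<in> nbhd G v \<longleftrightarrow> v \<in> nbhd G u" for u v
    using pair_sym_arcs by (auto simp: nbhd_def symmetric_def sym_def)
  have "nbhd G (vs ! i) - (\<Union>j<i. nbhd G (vs ! j)) \<noteq> {}" if i: "i < length vs" for i
  proof -
    have "vs ! i \<in> A" using i vs by auto
    then obtain u where u: "u \<in> pverts G" "nbhd G u \<inter> (A - {vs ! i}) = {}"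
      using priv by blast
    then have "vs ! i \<in> nbhd G u"
      using A(1) by (auto simp: total_dominating_set_def)
    moreover have "vs ! j \<notin> nbhd G u" if "j < i" for j
    proof -
      have "vs ! j \<in> A - {vs ! i}"
        using that i vs by (auto simp: nth_eq_iff_index_eq)
      then show ?thesis using u(2) by blast
    qed
    ultimately have "u \<in> nbhd G (vs ! i) - (\<Union>j<i. nbhd G (vs ! j))"
      using sym by auto
    then show ?thesis by blast
  qed
  then have "total_dominating_sequence G vs"
    using vs A(1)
    by (auto simp: total_dominating_sequence_def legal_sequence_def total_dominating_set_def)
  moreover have "length vs = total_domination_number G"
    using vs A(2) by (metis distinct_card total_domination_number_def)
  ultimately show thesis by (rule that)
qed

lemma total_uniform_iff:
  assumes "pair_graph G" "no_isolated_verts G"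
  shows "total_uniform k G \<longleftrightarrow> (\<forall>vs. total_dominating_sequence G vs \<longrightarrow> length vs = k)"
proof -
  have lower: "total_domination_number G \<le> length vs"
    if "total_dominating_sequence G vs" for vs
  proof -
    have "total_dominating_set G (set vs)" "card (set vs) = length vs"
      using that
      by (auto simp: total_dominating_sequence_def legal_sequence_def distinct_card)
    then have "Min {card A | A. total_dominating_set G A} \<le> card (set vs)"
      using finite_total_dominating_cards[OF assms(1)] \<open>total_dominating_set G (set vs)\<close>
      by (intro Min_le) blast+
    then show ?thesis
      using \<open>card (set vs) = length vs\<close> by (simp add: total_domination_number_def)
  qed
  have upper: "length vs \<le> grundy_total_domination_number G"
    if "total_dominating_sequence G vs" for vs
    using that finite_total_dominating_lengths[OF assms(1)]
    by (auto simp: grundy_total_domination_number_def intro!: Max_ge)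
  obtain ws where ws: "total_dominating_sequence G ws" "length ws = total_domination_number G"
    using total_dominating_sequence_minimum[OF assms] .
  have "Max {length vs | vs. total_dominating_sequence G vs}
        \<in> {length vs | vs. total_dominating_sequence G vs}"
    using finite_total_dominating_lengths[OF assms(1)] ws(1) by (intro Max_in) auto
  then obtain us where us: "total_dominating_sequence G us"
      "length us = grundy_total_domination_number G"
    by (auto simp: grundy_total_domination_number_def)
  show ?thesis
    using lower upper ws us assms(2) unfolding total_uniform_def
    by (metis le_antisym)
qed

end

theory Submission
  imports Defs
begin

text \<open>
  Let \<open>uv\<close> be an edge of a total \<open>k\<close>-uniform graph \<open>G\<close> and let \<open>H\<close> be the subgraph induced by the
  vertices adjacent to neither \<open>u\<close> nor \<open>v\<close>. Prefixing a total dominating sequence of \<open>H\<close> with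
  \<open>u, v\<close> gives a total dominating sequence of \<open>G\<close>. Moreover \<open>H\<close> has no isolated vertex: if \<open>w\<close> were
  one, its neighbours would all lie in \<open>N(u) \<union> N(v)\<close>, and if \<open>u, v, s\<close> is a total dominating sequence
  of \<open>G\<close>, then so is the longer \<open>w, u, v, s\<close>, in which \<open>u\<close> newly dominates \<open>v\<close> and \<open>v\<close> newly
  dominates \<open>u\<close>. Hence \<open>H\<close> is total \<open>(k - 2)\<close>-uniform, and descent excludes odd \<open>k\<close>.
\<close>

text \<open>\<open>D\<close> holds the vertices dominated before the list starts. Carrying it along
  reduces prefixing vertices and changing graphs to recursion on lists.\<close>

fun legal_from :: "'a pair_pre_digraph \<Rightarrow> 'a set \<Rightarrow> 'a list \<Rightarrow> bool" where
  "legal_from G D [] \<longleftrightarrow> True"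
| "legal_from G D (x # xs) \<longleftrightarrow>
     x \<in> pverts G \<and> \<not> nbhd G x \<subseteq> D \<and> legal_from G (D \<union> nbhd G x) xs"

lemma legal_from_iff_nth:
  "legal_from G D vs \<longleftrightarrow> set vs \<subseteq> pverts G \<and>
     (\<forall>i<length vs. \<not> nbhd G (vs ! i) \<subseteq> D \<union> (\<Union>j<i. nbhd G (vs ! j)))"
proof (induction vs arbitrary: D)
  case (Cons x xs)
  show ?case
    by (simp add: Cons.IH All_less_Suc2 lessThan_Suc_eq_insert_0 image_image Un_assoc) blast
qed simp

text \<open>Dominated vertices stay dominated, so \<open>x\<close> can never contribute a new one
  later. Applied to a vertex just played, this yields distinctness.\<close>

lemma legal_from_not_mem:
  assumes "legal_from G D vs" "nbhd G x \<subseteq> D"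
  shows "x \<notin> set vs"
  using assms by (induction vs arbitrary: D) auto

lemma legal_from_distinct: "legal_from G D vs \<Longrightarrow> distinct vs"
  by (induction vs arbitrary: D) (auto dest: legal_from_not_mem)

text \<open>The absence of isolated vertices supplies the condition on the first vertex, and
  \<open>legal_from\<close> forces distinctness.\<close>

lemma legal_sequence_iff_legal_from:
  assumes "no_isolated_verts G"
  shows "legal_sequence G vs \<longleftrightarrow> legal_from G {} vs"
proof
  assume legal: "legal_sequence G vs"
  have "\<not> nbhd G (vs ! i) \<subseteq> (\<Union>j<i. nbhd G (vs ! j))" if "i < length vs" for i
  proof (cases "i = 0")
    case True
    then show ?thesis
      using legal assms nth_mem[OF that]
      by (simp add: legal_sequence_def no_isolated_verts_def) blast
  next
    case False
    then have "i \<in> {1..<length vs}"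
      using that by auto
    then show ?thesis
      using legal unfolding legal_sequence_def by blast
  qed
  then show "legal_from G {} vs"
    using legal by (simp add: legal_from_iff_nth legal_sequence_def)
next
  assume "legal_from G {} vs"
  then show "legal_sequence G vs"
    using legal_from_distinct[of G "{}" vs]
    by (simp add: legal_from_iff_nth legal_sequence_def)
qed

lemma nbhd_sym:
  assumes "pair_graph G"
  shows "u \<in> nbhd G v \<longleftrightarrow> v \<in> nbhd G u"
proof -
  interpret pair_graph G by fact
  show ?thesis
    using pair_sym_arcs by (auto simp: nbhd_def symmetric_def sym_def)
qed

lemma nbhd_subset_pverts:
  assumes "pair_graph G"
  shows "nbhd G v \<subseteq> pverts G"
proof -
  interpret pair_graph G by fact
  show ?thesis
    using in_arcsD2 by (auto simp: nbhd_def)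
qed

lemma not_mem_nbhd_self:
  assumes "pair_graph G"
  shows "v \<notin> nbhd G v"
proof -
  interpret pair_graph G by fact
  show ?thesis
    using pair_no_loops by (fastforce simp: nbhd_def)
qed

lemma total_dominating_sequence_iff_legal_from:
  assumes "pair_graph G" "no_isolated_verts G"
  shows "total_dominating_sequence G vs \<longleftrightarrow>
    legal_from G {} vs \<and> pverts G \<subseteq> (\<Union>x\<in>set vs. nbhd G x)"
proof -
  have "set vs \<subseteq> pverts G" if "legal_from G {} vs"
    using that by (simp add: legal_from_iff_nth)
  moreover have "(\<forall>v\<in>pverts G. nbhd G v \<inter> set vs \<noteq> {}) \<longleftrightarrow>
      pverts G \<subseteq> (\<Union>x\<in>set vs. nbhd G x)"
    using nbhd_sym[OF assms(1)] by blast
  ultimately show ?thesis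
    unfolding total_dominating_sequence_def total_dominating_set_def
      legal_sequence_iff_legal_from[OF assms(2)] by blast
qed

text \<open>Greedy choice: an undominated \<open>x\<close> has a neighbour \<open>y\<close>, and
  playing \<open>y\<close> dominates \<open>x\<close>, so the undominated set shrinks.\<close>

lemma legal_from_extend_dominating:
  assumes "pair_graph G" "no_isolated_verts G"
  shows "\<exists>s. legal_from G D s \<and> pverts G \<subseteq> D \<union> (\<Union>x\<in>set s. nbhd G x)"
proof (induction "card (pverts G - D)" arbitrary: D rule: less_induct)
  case less
  interpret pair_graph G by (rule assms(1))
  show ?case
  proof (cases "pverts G \<subseteq> D")
    case True
    then show ?thesis
      by (intro exI[of _ "[]"]) simp
  next
    case False
    then obtain x where x: "x \<in> pverts G" "x \<notin> D"
      by blast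
    then obtain y where y: "y \<in> nbhd G x"
      using assms(2) by (auto simp: no_isolated_verts_def)
    then have xy: "x \<in> nbhd G y" and yV: "y \<in> pverts G"
      using nbhd_sym[OF assms(1)] nbhd_subset_pverts[OF assms(1)] by blast+
    have "card (pverts G - (D \<union> nbhd G y)) < card (pverts G - D)"
      using x xy pair_finite_verts by (intro psubset_card_mono) auto
    from less[OF this] obtain s where "legal_from G (D \<union> nbhd G y) s"
      "pverts G \<subseteq> D \<union> nbhd G y \<union> (\<Union>x\<in>set s. nbhd G x)"
      by blast
    then show ?thesis
      using x xy yV by (intro exI[of _ "y # s"]) auto
  qed
qed

definition induced :: "'a pair_pre_digraph \<Rightarrow> 'a set \<Rightarrow> 'a pair_pre_digraph" where
  "induced G W = \<lparr>pverts = W, parcs = parcs G \<inter> W \<times> W\<rparr>"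

lemma pverts_induced [simp]: "pverts (induced G W) = W"
  by (simp add: induced_def)

lemma nbhd_induced: "x \<in> W \<Longrightarrow> nbhd (induced G W) x = nbhd G x \<inter> W"
  by (auto simp: nbhd_def induced_def)

lemma pair_graph_induced:
  assumes "pair_graph G" "W \<subseteq> pverts G"
  shows "pair_graph (induced G W)"
proof -
  interpret pair_graph G by fact
  have "finite W"
    using assms(2) pair_finite_verts finite_subset by blast
  then show ?thesis
    using pair_sym_arcs pair_no_loops
    by unfold_locales (auto simp: induced_def symmetric_def sym_def arc_to_ends_def)
qed

text \<open>A newly dominated vertex in the subgraph lies in \<open>W\<close>, hence outside
  \<open>C\<close>, and is new in \<open>G\<close> as well. The subgraph sees only
  \<open>D \<inter> W\<close> because neighbourhoods in \<open>G\<close> may leave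
  \<open>W\<close>.\<close>

lemma legal_from_induced:
  assumes "legal_from (induced G W) (D \<inter> W) vs" "W \<subseteq> pverts G" "C \<inter> W = {}"
  shows "legal_from G (D \<union> C) vs"
  using assms(1)
proof (induction vs arbitrary: D)
  case (Cons x xs)
  then have x: "x \<in> W"
    by simp
  have "legal_from (induced G W) ((D \<union> nbhd G x) \<inter> W) xs"
    using Cons.prems x by (simp add: nbhd_induced Int_Un_distrib2)
  from Cons.IH[OF this] have "legal_from G (D \<union> C \<union> nbhd G x) xs"
    by (simp add: Un_ac)
  moreover have "\<not> nbhd G x \<subseteq> D \<union> C"
    using Cons.prems x assms(3) by (auto simp: nbhd_induced)
  ultimately show ?case
    using x assms(2) by auto
qed simp

lemma total_uniform_remove_edge_nbhds:
  assumes G: "pair_graph G" and unif: "total_uniform k G" and uv: "v \<in> nbhd G u"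
  defines "W \<equiv> pverts G - (nbhd G u \<union> nbhd G v)"
  shows "k \<ge> 2" "total_uniform (k - 2) (induced G W)"
proof -
  have iso: "no_isolated_verts G"
    using unif by (simp add: total_uniform_def)
  have len: "length vs = k"
    if "legal_from G {} vs" "pverts G \<subseteq> (\<Union>x\<in>set vs. nbhd G x)" for vs
    using that unif total_uniform_iff[OF G iso]
      total_dominating_sequence_iff_legal_from[OF G iso] by blast
  have vu: "u \<in> nbhd G v"
    using uv nbhd_sym[OF G] by blast
  have uvV: "u \<in> pverts G" "v \<in> pverts G"
    using uv vu nbhd_subset_pverts[OF G] by blast+
  have uu: "u \<notin> nbhd G u"
    by (rule not_mem_nbhd_self[OF G])
  \<comment> \<open>After \<open>u\<close>, the vertex \<open>v\<close> is legal because it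
    dominates \<open>u\<close>, which is not its own neighbour.\<close>
  have prefix_uv: "length s + 2 = k"
    if "legal_from G (nbhd G u \<union> nbhd G v) s"
      "pverts G \<subseteq> nbhd G u \<union> nbhd G v \<union> (\<Union>x\<in>set s. nbhd G x)" for s
    using len[of "u # v # s"] that uv vu uu uvV by (auto simp: Un_assoc)
  obtain s where s: "legal_from G (nbhd G u \<union> nbhd G v) s"
      "pverts G \<subseteq> nbhd G u \<union> nbhd G v \<union> (\<Union>x\<in>set s. nbhd G x)"
    using legal_from_extend_dominating[OF G iso] by blast
  show "k \<ge> 2"
    using prefix_uv[OF s] by simp
  have WV: "W \<subseteq> pverts G"
    by (auto simp: W_def)
  have graph_W: "pair_graph (induced G W)"
    using G WV by (rule pair_graph_induced)
  have "nbhd G w \<inter> W \<noteq> {}" if w: "w \<in> W" for w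
  proof
    assume "nbhd G w \<inter> W = {}"
    then have sub: "nbhd G w \<subseteq> nbhd G u \<union> nbhd G v"
      using nbhd_subset_pverts[OF G] by (auto simp: W_def)
    \<comment> \<open>Since \<open>w\<close> is adjacent to neither \<open>u\<close> nor
      \<open>v\<close>, both are still undominated after playing \<open>w\<close>.\<close>
    have "nbhd G w \<noteq> {}" "u \<notin> nbhd G w" "v \<notin> nbhd G w" "w \<in> pverts G"
      using w iso nbhd_sym[OF G] by (auto simp: W_def no_isolated_verts_def)
    \<comment> \<open>After \<open>w, u, v\<close> the dominated set is the same as after
      \<open>u, v\<close>, so the same \<open>s\<close> completes both sequences.\<close>
    moreover have "nbhd G w \<union> nbhd G u \<union> nbhd G v = nbhd G u \<union> nbhd G v"
      using sub by blast
    ultimately have "legal_from G {} (w # u # v # s)"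
      using s(1) uv vu uu uvV by auto
    moreover have "pverts G \<subseteq> (\<Union>x\<in>set (w # u # v # s). nbhd G x)"
      using s(2) by auto
    ultimately have "length (w # u # v # s) = k"
      by (rule len)
    then show False
      using prefix_uv[OF s] by simp
  qed
  then have iso_W: "no_isolated_verts (induced G W)"
    by (auto simp: no_isolated_verts_def nbhd_induced)
  have "length vs = k - 2" if "total_dominating_sequence (induced G W) vs" for vs
  proof -
    have vs: "legal_from (induced G W) {} vs" "W \<subseteq> (\<Union>x\<in>set vs. nbhd (induced G W) x)"
      using that total_dominating_sequence_iff_legal_from[OF graph_W iso_W] by auto
    have "set vs \<subseteq> W"
      using vs(1) by (simp add: legal_from_iff_nth)
    then have "W \<subseteq> (\<Union>x\<in>set vs. nbhd G x)"
      using vs(2) by (force simp: nbhd_induced)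
    then have "pverts G \<subseteq> nbhd G u \<union> nbhd G v \<union> (\<Union>x\<in>set vs. nbhd G x)"
      by (auto simp: W_def)
    \<comment> \<open>Here \<open>D\<close> is empty and \<open>C\<close> is the union of the two
      neighbourhoods, disjoint from \<open>W\<close> by construction.\<close>
    moreover have "legal_from G ({} \<union> (nbhd G u \<union> nbhd G v)) vs"
      using vs(1) WV by (intro legal_from_induced[where W = W]) (auto simp: W_def)
    ultimately show ?thesis
      using prefix_uv[of vs] by simp
  qed
  then show "total_uniform (k - 2) (induced G W)"
    using total_uniform_iff[OF graph_W iso_W] by blast
qed

lemma total_uniform_even:
  assumes "pair_graph G" "total_uniform k G"
  shows "even k"
  using assms
proof (induction k arbitrary: G rule: less_induct)
  case (less k)
  have iso: "no_isolated_verts G"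
    using less.prems by (simp add: total_uniform_def)
  show ?case
  proof (cases "pverts G = {}")
    case True
    \<comment> \<open>The descent ends at the empty graph, which the empty sequence
      dominates.\<close>
    then have "total_dominating_sequence G []"
      using total_dominating_sequence_iff_legal_from[OF less.prems(1) iso] by simp
    then have "k = 0"
      using less.prems total_uniform_iff[OF less.prems(1) iso] by force
    then show ?thesis
      by simp
  next
    case False
    then obtain u v where "v \<in> nbhd G u"
      using iso unfolding no_isolated_verts_def by blast
    note reduce = total_uniform_remove_edge_nbhds[OF less.prems this]
    \<comment> \<open>Subtraction truncates at 0: \<open>reduce(1)\<close> ensures that
      \<open>k - 2\<close> is smaller than \<open>k\<close> and has the same parity.\<close>
    have "even (k - 2)"
      using reduce less.prems(1) by (intro less.IH[OF _ _ reduce(2)] pair_graph_induced) auto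
    then show ?thesis
      using reduce(1) by simp
  qed
qed

theorem theorem2p3:
  fixes k :: nat
  assumes "odd k"
  shows "\<not> (\<exists>G :: 'a pair_pre_digraph. pair_graph G \<and> total_uniform k G)"
  using assms total_uniform_even by blast

end
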